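(* Let $\lambda\geqslant 1$ be a cardinal, let $S$ be a monoid with zero, and let $B_{\lambda}^0(S)$ be the Brandt $\lambda^0$-extension of $S$. Let $\mathscr{S}_{\lambda}$ be the group of all bijections of $\lambda$, $\mathbf{Aut}(S)$ the group of all automorphisms of the semigroup $S$, and $H_1^{\lambda}$ the direct $\lambda$-power of the group of units $H_1$ of $S$ (i.e. the group of all maps $\lambda\to H_1$ with pointwise multiplication). Then the Cartesian product $\mathscr{S}_{\lambda}\times\mathbf{Aut}(S)\times H_1^{\lambda}$ is a group under the binary operation $$[\varphi,h,u]\cdot[\varphi',h',u']=[\varphi\varphi',\,hh',\,\varphi u'\cdot uh'],$$ and the group $\mathbf{Aut}(B_{\lambda}^0(S))$ of automorphisms of $B_{\lambda}^0(S)$ is isomorphic to a homomorphic image of this group. Moreover, the inverse element of $[\varphi,h,u]$ in the group $\mathbf{Aut}(B_{\lambda}^0(S))$ is given by $$[\varphi,h,u]^{-1}=\left[\varphi^{-1},\,h^{-1},\,\varphi^{-1}u^{-1}h^{-1}\right].$$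
   Context: Maps are written on the right: $(x)f$ is the image of $x$ under $f$, and compositions are read left to right, so $(\alpha)(\varphi\varphi')=((\alpha)\varphi)\varphi'$ and $(s)(hh')=((s)h)h'$. For $u,u'\in H_1^\lambda$, $\varphi\in\mathscr{S}_\lambda$, $h'\in\mathbf{Aut}(S)$, the map $\varphi u'\cdot uh'\colon\lambda\to H_1$ is $(\alpha)(\varphi u'\cdot uh')=((\alpha)\varphi)u'\cdot((\alpha)u)h'$; $u^{-1}$ denotes the pointwise inverse in $H_1^\lambda$, and $\varphi^{-1}u^{-1}h^{-1}\colon\lambda\to H_1$ is the map $\alpha\mapsto\big((((\alpha)\varphi^{-1})u)^{-1}\big)h^{-1}$. The zero of $S$ is denoted $0_S$. For a semigroup $S$ with zero and a cardinal $\lambda\geqslant 1$ (regarded as a set), let $B_{\lambda}(S)=(\lambda\times S\times\lambda)\cup\{0\}$ with multiplication $(\alpha,a,\beta)\cdot(\gamma,b,\delta)=(\alpha,ab,\delta)$ if $\beta=\gamma$ and $=0$ if $\beta\neq\gamma$, and $(\alpha,a,\beta)\cdot 0=0\cdot(\alpha,a,\beta)=0\cdot 0=0$. The set $\mathcal{J}=\{0\}\cup\{(\alpha,0_S,\beta)\colon\alpha,\beta\in\lambda\}$ is an ideal of $B_\lambda(S)$, and the Brandt $\lambda^0$-extension of $S$ is the Rees quotient semigroup $B^0_{\lambda}(S)=B_\lambda(S)/\mathcal{J}$; thus its elements are $0$ and the triples $(\alpha,s,\beta)$ with $\alpha,\beta\in\lambda$ and $s\in S\setminus\{0_S\}$.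 As an element of $\mathbf{Aut}(B_{\lambda}^0(S))$, the triple $[\varphi,h,u]$ (with $\varphi\in\mathscr{S}_\lambda$, $h\in\mathbf{Aut}(S)$, $u\colon\lambda\to H_1$) denotes the automorphism $\sigma$ given by $((\alpha,s,\beta))\sigma=((\alpha)\varphi,(\alpha)u\cdot(s)h\cdot((\beta)u)^{-1},(\beta)\varphi)$ for $s\neq 0_S$ and $(0)\sigma=0$. *)

theory Defs
  imports "HOL-Algebra.Bij" "HOL-Algebra.Product_Groups"
begin

definition is_zero :: "('a, 'b) monoid_scheme \<Rightarrow> 'a \<Rightarrow> bool" where
  "is_zero S z \<longleftrightarrow> z \<in> carrier S \<and>
     (\<forall>s \<in> carrier S. z \<otimes>\<^bsub>S\<^esub> s = z \<and> s \<otimes>\<^bsub>S\<^esub> z = z)"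

text \<open>Maps act on the right, so products of maps are read left to right: the product of
  \<open>f\<close> and \<open>g\<close> is ``first \<open>f\<close>, then \<open>g\<close>''. This is the opposite of the order used in
  \<^const>\<open>BijGroup\<close> and \<^const>\<open>AutoGroup\<close>. As there, maps are extensional on their domain.\<close>

definition sym_group :: "'i set \<Rightarrow> ('i \<Rightarrow> 'i) monoid" where
  "sym_group I =
     \<lparr>carrier = Bij I, mult = (\<lambda>f g. compose I g f), one = (\<lambda>\<alpha> \<in> I. \<alpha>)\<rparr>"

text \<open>The set \<^term>\<open>auto S\<close> refers only to \<^term>\<open>carrier S\<close> and the multiplication of \<^term>\<open>S\<close>,
  so it is the set of semigroup automorphisms of \<^term>\<open>S\<close>.\<close>

definition aut_group :: "('a, 'b) monoid_scheme \<Rightarrow> ('a \<Rightarrow> 'a) monoid" where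
  "aut_group S =
     \<lparr>carrier = auto S, mult = (\<lambda>f g. compose (carrier S) g f), one = (\<lambda>s \<in> carrier S. s)\<rparr>"

abbreviation unit_power :: "'i set \<Rightarrow> ('a, 'b) monoid_scheme \<Rightarrow> ('i \<Rightarrow> 'a) monoid" where
  "unit_power I S \<equiv> product_group I (\<lambda>_. units_of S)"


text \<open>In \<open>B\<^sub>\<lambda>(S)\<close> the adjoined zero is \<^const>\<open>None\<close>. The semigroup need not have an identity;
  the field \<open>one\<close> of the record is irrelevant and left unspecified.\<close>

fun brandt_mult ::
  "('a, 'b) monoid_scheme \<Rightarrow> ('i \<times> 'a \<times> 'i) option \<Rightarrow> ('i \<times> 'a \<times> 'i) option
     \<Rightarrow> ('i \<times> 'a \<times> 'i) option" where
  "brandt_mult S (Some (\<alpha>, a, \<beta>)) (Some (\<gamma>, b, \<delta>)) =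
     (if \<beta> = \<gamma> then Some (\<alpha>, a \<otimes>\<^bsub>S\<^esub> b, \<delta>) else None)"
| "brandt_mult S None y = None"
| "brandt_mult S x None = None"

definition brandt :: "'i set \<Rightarrow> ('a, 'b) monoid_scheme \<Rightarrow> ('i \<times> 'a \<times> 'i) option monoid" where
  "brandt I S =
     \<lparr>carrier = insert None (Some ` (I \<times> carrier S \<times> I)), mult = brandt_mult S, one = undefined\<rparr>"

definition brandt_ideal :: "'i set \<Rightarrow> 'a \<Rightarrow> ('i \<times> 'a \<times> 'i) option set" where
  "brandt_ideal I z = insert None {Some (\<alpha>, z, \<beta>) | \<alpha> \<beta>. \<alpha> \<in> I \<and> \<beta> \<in> I}"

text \<open>The Rees quotient \<open>T / J\<close>: the class \<open>J\<close> is represented by the chosen element \<open>j \<in> J\<close>,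
  every other class is a singleton \<open>{x}\<close> and is represented by \<open>x\<close>.\<close>

definition rees_quotient :: "('a, 'b) monoid_scheme \<Rightarrow> 'a set \<Rightarrow> 'a \<Rightarrow> 'a monoid" where
  "rees_quotient T J j =
     \<lparr>carrier = insert j (carrier T - J),
      mult = (\<lambda>x y. if x \<otimes>\<^bsub>T\<^esub> y \<in> J then j else x \<otimes>\<^bsub>T\<^esub> y),
      one = undefined\<rparr>"

definition brandt0 ::
  "'i set \<Rightarrow> ('a, 'b) monoid_scheme \<Rightarrow> 'a \<Rightarrow> ('i \<times> 'a \<times> 'i) option monoid" where
  "brandt0 I S z = rees_quotient (brandt I S) (brandt_ideal I z) None"

lemma carrier_brandt0:
  "carrier (brandt0 I S z) = insert None (Some ` (I \<times> (carrier S - {z}) \<times> I))"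
  by (auto simp: brandt0_def rees_quotient_def brandt_def brandt_ideal_def)


text \<open>The triples \<open>[\<phi>, h, u]\<close> with
  \<open>[\<phi>, h, u] \<cdot> [\<phi>', h', u'] = [\<phi>\<phi>', hh', \<phi>u' \<cdot> uh']\<close>.\<close>

definition triple_group ::
  "'i set \<Rightarrow> ('a, 'b) monoid_scheme \<Rightarrow> (('i \<Rightarrow> 'i) \<times> ('a \<Rightarrow> 'a) \<times> ('i \<Rightarrow> 'a)) monoid" where
  "triple_group I S =
     \<lparr>carrier = carrier (sym_group I) \<times> carrier (aut_group S) \<times> carrier (unit_power I S),
      mult = (\<lambda>(\<phi>, h, u) (\<phi>', h', u').
        (\<phi> \<otimes>\<^bsub>sym_group I\<^esub> \<phi>', h \<otimes>\<^bsub>aut_group S\<^esub> h',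
         compose I u' \<phi> \<otimes>\<^bsub>unit_power I S\<^esub> compose I h' u)),
      one = (\<one>\<^bsub>sym_group I\<^esub>, \<one>\<^bsub>aut_group S\<^esub>, \<one>\<^bsub>unit_power I S\<^esub>)\<rparr>"

fun triple_inv ::
  "'i set \<Rightarrow> ('a, 'b) monoid_scheme \<Rightarrow> ('i \<Rightarrow> 'i) \<times> ('a \<Rightarrow> 'a) \<times> ('i \<Rightarrow> 'a)
     \<Rightarrow> ('i \<Rightarrow> 'i) \<times> ('a \<Rightarrow> 'a) \<times> ('i \<Rightarrow> 'a)" where
  "triple_inv I S (\<phi>, h, u) =
     (restrict (inv_into I \<phi>) I,
      restrict (inv_into (carrier S) h) (carrier S),
      \<lambda>\<alpha> \<in> I. inv_into (carrier S) h (inv\<^bsub>S\<^esub> (u (inv_into I \<phi> \<alpha>))))"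

fun triple_aut ::
  "'i set \<Rightarrow> ('a, 'b) monoid_scheme \<Rightarrow> 'a \<Rightarrow> ('i \<Rightarrow> 'i) \<times> ('a \<Rightarrow> 'a) \<times> ('i \<Rightarrow> 'a)
     \<Rightarrow> ('i \<times> 'a \<times> 'i) option \<Rightarrow> ('i \<times> 'a \<times> 'i) option" where
  "triple_aut I S z (\<phi>, h, u) =
     (\<lambda>x \<in> carrier (brandt0 I S z).
        case x of
          None \<Rightarrow> None
        | Some (\<alpha>, s, \<beta>) \<Rightarrow> Some (\<phi> \<alpha>, u \<alpha> \<otimes>\<^bsub>S\<^esub> h s \<otimes>\<^bsub>S\<^esub> inv\<^bsub>S\<^esub> (u \<beta>), \<phi> \<beta>))"

end

theory Submission
  imports Defs
begin

text \<open>The assignment of the map \<open>[\<phi>, h, u]\<close> to a triple is an epimorphism from the group of triples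
  onto \<open>Aut(B\<^sub>\<lambda>\<^sup>0(S))\<close>, so the automorphism group itself serves as the homomorphic image.

  That the assignment is multiplicative is a computation: following \<open>[\<phi>, h, u]\<close> by \<open>[\<phi>', h', u']\<close> sends
  the middle component \<open>s\<close> of \<open>(\<alpha>, s, \<beta>)\<close> to \<open>((\<alpha>)\<phi>)u' \<cdot> ((\<alpha>)u)h' \<cdot> (s)hh'\<close> times the inverse of
  \<open>((\<beta>)\<phi>)u' \<cdot> ((\<beta>)u)h'\<close>, which is the rule for multiplying triples. Bijectivity of the maps
  and the formula for their inverses then come from the inverses in the group of triples.

  Surjectivity is the essential part. If \<open>1 \<noteq> 0\<^sub>S\<close>, an automorphism \<open>\<sigma>\<close> permutes the
  idempotents \<open>(\<alpha>, 1, \<alpha>)\<close> (\<open>auto_idem\<close>), say by \<open>\<phi>\<close>. It therefore maps the elements with indices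
  \<open>\<alpha>\<close> and \<open>\<beta>\<close> bijectively to those with indices \<open>(\<alpha>)\<phi>\<close> and \<open>(\<beta>)\<phi>\<close>. With a fixed index \<open>\<omega>\<close>, the action
  on the elements \<open>(\<omega>, s, \<omega>)\<close>, which form a copy of \<open>S\<close>, is the automorphism \<open>h\<close>, and the middle
  component of the image of \<open>(\<alpha>, 1, \<omega>)\<close> is the unit \<open>(\<alpha>)u\<close>, whose inverse is read off from
  \<open>(\<omega>, 1, \<alpha>)\<close>. Since \<open>(\<alpha>, s, \<beta>) = (\<alpha>, 1, \<omega>) (\<omega>, s, \<omega>) (\<omega>, 1, \<beta>)\<close>, these data determine \<open>\<sigma>\<close>
  (\<open>auto_eq_triple_aut\<close>). If \<open>1 = 0\<^sub>S\<close>, the semigroup has a single element.\<close>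

section \<open>Groups of bijections and of automorphisms, with products read from left to right\<close>

lemma group_sym_group: "group (sym_group I)"
proof (rule groupI)
  fix f assume "f \<in> carrier (sym_group I)"
  then have f: "f \<in> Bij I"
    by (simp add: sym_group_def)
  then have "compose I f (restrict (inv_into I f) I) = (\<lambda>\<alpha>\<in>I. \<alpha>)"
    by (auto simp: Bij_def bij_betw_def compose_def fun_eq_iff inv_into_into f_inv_into_f)
  with f show "\<exists>g\<in>carrier (sym_group I). g \<otimes>\<^bsub>sym_group I\<^esub> f = \<one>\<^bsub>sym_group I\<^esub>"
    by (auto simp: sym_group_def intro!: bexI[OF _ restrict_inv_into_Bij])
next
  fix f g k assume "f \<in> carrier (sym_group I)" "g \<in> carrier (sym_group I)"
  then show "f \<otimes>\<^bsub>sym_group I\<^esub> g \<otimes>\<^bsub>sym_group I\<^esub> k = f \<otimes>\<^bsub>sym_group I\<^esub> (g \<otimes>\<^bsub>sym_group I\<^esub> k)"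
    by (simp add: sym_group_def compose_assoc Bij_imp_funcset)
next
  fix f assume "f \<in> carrier (sym_group I)"
  then show "\<one>\<^bsub>sym_group I\<^esub> \<otimes>\<^bsub>sym_group I\<^esub> f = f"
    using compose_Id[of f I I] by (simp add: sym_group_def Bij_imp_extensional Bij_imp_funcset)
qed (simp_all add: sym_group_def compose_Bij id_Bij)

lemma inv_sym_group:
  assumes "f \<in> Bij I"
  shows "inv\<^bsub>sym_group I\<^esub> f = restrict (inv_into I f) I"
proof (rule group.inv_equality[OF group_sym_group])
  show "restrict (inv_into I f) I \<otimes>\<^bsub>sym_group I\<^esub> f = \<one>\<^bsub>sym_group I\<^esub>"
    using assms
    by (auto simp: sym_group_def Bij_def bij_betw_def compose_def fun_eq_iff f_inv_into_f)
qed (use assms in \<open>simp_all add: sym_group_def restrict_inv_into_Bij\<close>)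

lemma inverse_in_auto:
  assumes closed: "mult T \<in> carrier T \<rightarrow> carrier T \<rightarrow> carrier T" and h: "h \<in> auto T"
  shows "restrict (inv_into (carrier T) h) (carrier T) \<in> auto T"
proof -
  have "h \<in> Bij (carrier T)" and hom: "h \<in> hom T T"
    using h by (auto simp: auto_def)
  then show ?thesis
    using closed Bij_inv_into_lemma[where S = "carrier T" and g = "mult T", OF hom_mult[OF hom]]
    by (auto simp: auto_def hom_def restrict_inv_into_Bij Bij_inv_into_mem Pi_iff)
qed

lemma group_aut_group:
  assumes closed: "mult T \<in> carrier T \<rightarrow> carrier T \<rightarrow> carrier T"
  shows "group (aut_group T)"
proof -
  have "subgroup (auto T) (sym_group (carrier T))"
  proof (rule subgroup.intro)
    show "auto T \<subseteq> carrier (sym_group (carrier T))"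
      by (auto simp: auto_def sym_group_def)
    show "f \<otimes>\<^bsub>sym_group (carrier T)\<^esub> g \<in> auto T" if "f \<in> auto T" "g \<in> auto T" for f g
      using that closed
      by (auto simp: auto_def sym_group_def compose_Bij hom_def Pi_iff compose_eq)
    show "\<one>\<^bsub>sym_group (carrier T)\<^esub> \<in> auto T"
      using closed by (auto simp: auto_def sym_group_def id_Bij hom_def Pi_iff)
    show "inv\<^bsub>sym_group (carrier T)\<^esub> f \<in> auto T" if "f \<in> auto T" for f
      using inverse_in_auto[OF closed that] that by (simp add: inv_sym_group auto_def)
  qed
  then have "group (sym_group (carrier T)\<lparr>carrier := auto T\<rparr>)"
    by (rule subgroup.subgroup_is_group) (rule group_sym_group)
  then show ?thesis
    by (simp add: aut_group_def sym_group_def)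
qed

lemma auto_closed: "h \<in> auto S \<Longrightarrow> s \<in> carrier S \<Longrightarrow> h s \<in> carrier S"
  by (auto simp: auto_def hom_def)

lemma auto_mult:
  "h \<in> auto S \<Longrightarrow> s \<in> carrier S \<Longrightarrow> t \<in> carrier S \<Longrightarrow> h (s \<otimes>\<^bsub>S\<^esub> t) = h s \<otimes>\<^bsub>S\<^esub> h t"
  by (auto simp: auto_def hom_def)

lemma auto_image: "h \<in> auto S \<Longrightarrow> h ` carrier S = carrier S"
  by (auto simp: auto_def Bij_def bij_betw_def)

lemma auto_inj: "h \<in> auto S \<Longrightarrow> inj_on h (carrier S)"
  by (auto simp: auto_def Bij_def bij_betw_def)

lemma auto_extensional: "h \<in> auto S \<Longrightarrow> h \<in> extensional (carrier S)"
  by (auto simp: auto_def Bij_def)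

text \<open>An automorphism is only required to respect multiplication; surjectivity makes it fix every
  element that is characterised by equations over the whole carrier, such as the identity.\<close>

lemma (in monoid) auto_one:
  assumes h: "h \<in> auto G"
  shows "h \<one> = \<one>"
proof (rule one_unique)
  show "h \<one> \<in> carrier G"
    using h by (simp add: auto_closed)
  fix x assume "x \<in> carrier G"
  then obtain y where "y \<in> carrier G" "x = h y"
    using auto_image[OF h] by auto
  then show "h \<one> \<otimes> x = x"
    using auto_mult[OF h, of \<one> y] by simp
qed

lemma auto_zero:
  assumes h: "h \<in> auto S" and z: "is_zero S z"
  shows "h z = z"
proof -
  obtain y where "y \<in> carrier S" "h y = z"
    using auto_image[OF h] z by (metis imageE is_zero_def)
  then show ?thesis
    using auto_mult[OF h, of z y] auto_closed[OF h, of z] z by (metis is_zero_def)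
qed

lemma (in monoid) auto_Units:
  assumes h: "h \<in> auto G" and x: "x \<in> Units G"
  shows "h x \<in> Units G" and "h (inv x) = inv (h x)"
proof -
  have eqs: "h x \<otimes> h (inv x) = \<one>" "h (inv x) \<otimes> h x = \<one>"
    using x h by (simp_all add: auto_mult[OF h, symmetric] Units_closed auto_one)
  moreover have "h x \<in> carrier G" "h (inv x) \<in> carrier G"
    using x h by (simp_all add: auto_closed Units_closed)
  ultimately show "h x \<in> Units G"
    unfolding Units_def by blast
  show "h (inv x) = inv (h x)"
    using inv_unique'[OF _ _ eqs] x h by (simp add: auto_closed Units_closed)
qed

lemma (in monoid) inv_mult_Units:
  assumes "x \<in> Units G" "y \<in> Units G"
  shows "inv (x \<otimes> y) = inv y \<otimes> inv x"
proof (rule inv_unique'[symmetric])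
  have "x \<otimes> y \<otimes> (inv y \<otimes> inv x) = x \<otimes> (y \<otimes> inv y) \<otimes> inv x"
    using assms by (simp add: m_assoc Units_closed del: Units_r_inv)
  then show "x \<otimes> y \<otimes> (inv y \<otimes> inv x) = \<one>"
    using assms by (simp add: Units_closed)
  have "inv y \<otimes> inv x \<otimes> (x \<otimes> y) = inv y \<otimes> (inv x \<otimes> x) \<otimes> y"
    using assms by (simp add: m_assoc Units_closed del: Units_l_inv)
  then show "inv y \<otimes> inv x \<otimes> (x \<otimes> y) = \<one>"
    using assms by (simp add: Units_closed)
qed (use assms in \<open>simp_all add: Units_closed\<close>)

section \<open>The group of triples\<close>

lemma carrier_triple_group:
  "(\<phi>, h, u) \<in> carrier (triple_group I S) \<longleftrightarrow>
     \<phi> \<in> Bij I \<and> h \<in> auto S \<and> u \<in> (\<Pi>\<^sub>E i\<in>I. Units S)"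
  by (simp add: triple_group_def sym_group_def aut_group_def units_of_def)

lemma mult_triple_group:
  "(\<phi>, h, u) \<otimes>\<^bsub>triple_group I S\<^esub> (\<phi>', h', u') =
     (compose I \<phi>' \<phi>, compose (carrier S) h' h, \<lambda>\<alpha>\<in>I. u' (\<phi> \<alpha>) \<otimes>\<^bsub>S\<^esub> h' (u \<alpha>))"
  by (auto simp: triple_group_def sym_group_def aut_group_def units_of_def compose_def)

lemma one_triple_group:
  "\<one>\<^bsub>triple_group I S\<^esub> = ((\<lambda>\<alpha>\<in>I. \<alpha>), (\<lambda>s\<in>carrier S. s), (\<lambda>\<alpha>\<in>I. \<one>\<^bsub>S\<^esub>))"
  by (simp add: triple_group_def sym_group_def aut_group_def units_of_def)

context monoid
begin

lemma group_aut_monoid: "group (aut_group G)"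
  by (rule group_aut_group) auto

lemma triple_inv_closed:
  assumes t: "t \<in> carrier (triple_group I G)"
  shows "triple_inv I G t \<in> carrier (triple_group I G)"
proof -
  obtain \<phi> h u where t_eq: "t = (\<phi>, h, u)"
    by (cases t)
  with t have \<phi>: "\<phi> \<in> Bij I" and h: "h \<in> auto G" and u: "u \<in> (\<Pi>\<^sub>E i\<in>I. Units G)"
    by (simp_all add: carrier_triple_group)
  let ?k = "restrict (inv_into (carrier G) h) (carrier G)"
  have k: "?k \<in> auto G"
    by (rule inverse_in_auto[OF _ h]) auto
  have "inv_into (carrier G) h (inv (u (inv_into I \<phi> \<alpha>))) \<in> Units G" if "\<alpha> \<in> I" for \<alpha>
  proof -
    have "inv (u (inv_into I \<phi> \<alpha>)) \<in> Units G"
      using u Bij_inv_into_mem[OF \<phi> that] by (auto simp: PiE_iff)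
    then show ?thesis
      using auto_Units(1)[OF k] by (simp add: Units_closed)
  qed
  with \<phi> k show ?thesis
    by (simp add: t_eq carrier_triple_group restrict_inv_into_Bij)
qed

lemma triple_inv_left:
  assumes t: "t \<in> carrier (triple_group I G)"
  shows "triple_inv I G t \<otimes>\<^bsub>triple_group I G\<^esub> t = \<one>\<^bsub>triple_group I G\<^esub>"
proof -
  obtain \<phi> h u where t_eq: "t = (\<phi>, h, u)"
    by (cases t)
  with t have \<phi>: "\<phi> \<in> Bij I" and h: "h \<in> auto G" and u: "u \<in> (\<Pi>\<^sub>E i\<in>I. Units G)"
    by (simp_all add: carrier_triple_group)
  have 1: "compose I \<phi> (restrict (inv_into I \<phi>) I) = (\<lambda>\<alpha>\<in>I. \<alpha>)"
    using \<phi> by (auto simp: Bij_def bij_betw_def compose_def fun_eq_iff f_inv_into_f)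
  have 2: "compose (carrier G) h (restrict (inv_into (carrier G) h) (carrier G)) = (\<lambda>s\<in>carrier G. s)"
    using auto_image[OF h] by (auto simp: compose_def fun_eq_iff f_inv_into_f)
  have 3: "u (inv_into I \<phi> \<alpha>) \<otimes> h (inv_into (carrier G) h (inv (u (inv_into I \<phi> \<alpha>)))) = \<one>"
    if "\<alpha> \<in> I" for \<alpha>
  proof -
    have "u (inv_into I \<phi> \<alpha>) \<in> Units G"
      using u Bij_inv_into_mem[OF \<phi> that] by (auto simp: PiE_iff)
    then show ?thesis
      using auto_image[OF h] by (simp add: f_inv_into_f)
  qed
  show ?thesis
    unfolding t_eq triple_inv.simps mult_triple_group one_triple_group 1 2
    using 3 by (auto simp: fun_eq_iff)
qed

lemma group_triple_group: "group (triple_group I G)"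
proof (rule groupI)
  fix t t' assume "t \<in> carrier (triple_group I G)" "t' \<in> carrier (triple_group I G)"
  moreover obtain \<phi> h u \<phi>' h' u' where "t = (\<phi>, h, u)" "t' = (\<phi>', h', u')"
    by (cases t, cases t')
  moreover have "h' \<otimes>\<^bsub>aut_group G\<^esub> h \<in> auto G" if "h \<in> auto G" "h' \<in> auto G" for h h'
    using monoid.m_closed[OF group.is_monoid[OF group_aut_monoid]] that
    by (simp add: aut_group_def)
  ultimately show "t \<otimes>\<^bsub>triple_group I G\<^esub> t' \<in> carrier (triple_group I G)"
    by (auto simp: carrier_triple_group mult_triple_group compose_Bij aut_group_def auto_Units
        PiE_iff Bij_imp_funcset[THEN funcset_mem] intro!: Units_m_closed)
next
  show "\<one>\<^bsub>triple_group I G\<^esub> \<in> carrier (triple_group I G)"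
    using monoid.one_closed[OF group.is_monoid[OF group_aut_monoid]]
    by (auto simp: one_triple_group carrier_triple_group id_Bij aut_group_def)
next
  fix t t' t''
  assume "t \<in> carrier (triple_group I G)" "t' \<in> carrier (triple_group I G)"
    "t'' \<in> carrier (triple_group I G)"
  moreover obtain \<phi> h u \<phi>' h' u' \<phi>'' h'' u''
    where "t = (\<phi>, h, u)" "t' = (\<phi>', h', u')" "t'' = (\<phi>'', h'', u'')"
    by (cases t, cases t', cases t'')
  ultimately show "t \<otimes>\<^bsub>triple_group I G\<^esub> t' \<otimes>\<^bsub>triple_group I G\<^esub> t''
    = t \<otimes>\<^bsub>triple_group I G\<^esub> (t' \<otimes>\<^bsub>triple_group I G\<^esub> t'')"
    by (auto simp: carrier_triple_group mult_triple_group compose_def fun_eq_iff auto_closed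
        auto_mult PiE_iff Bij_imp_funcset[THEN funcset_mem] Units_closed m_assoc)
next
  fix t assume "t \<in> carrier (triple_group I G)"
  moreover obtain \<phi> h u where "t = (\<phi>, h, u)"
    by (cases t)
  ultimately show "\<one>\<^bsub>triple_group I G\<^esub> \<otimes>\<^bsub>triple_group I G\<^esub> t = t"
    by (auto simp: carrier_triple_group mult_triple_group one_triple_group compose_def fun_eq_iff
        PiE_iff extensional_def Units_closed auto_one Bij_def dest: auto_extensional)
next
  fix t assume "t \<in> carrier (triple_group I G)"
  then show "\<exists>t'\<in>carrier (triple_group I G). t' \<otimes>\<^bsub>triple_group I G\<^esub> t = \<one>\<^bsub>triple_group I G\<^esub>"
    using triple_inv_closed triple_inv_left by blast
qed

lemma inv_triple_group:
  assumes "t \<in> carrier (triple_group I G)"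
  shows "inv\<^bsub>triple_group I G\<^esub> t = triple_inv I G t"
  by (rule group.inv_equality[OF group_triple_group triple_inv_left[OF assms] assms
        triple_inv_closed[OF assms]])

end

section \<open>Multiplication in the Brandt extension\<close>

text \<open>Reading \<open>(\<alpha>, 0\<^sub>S, \<beta>)\<close> as the zero of the Brandt extension makes every element of it a triple,
  and the product of triples is then given by one formula, whether or not the product of the middle
  components vanishes.\<close>

definition triple :: "'a \<Rightarrow> 'i \<Rightarrow> 'a \<Rightarrow> 'i \<Rightarrow> ('i \<times> 'a \<times> 'i) option" where
  "triple z \<alpha> s \<beta> = (if s = z then None else Some (\<alpha>, s, \<beta>))"

lemma triple_inject [simp]: "triple z \<alpha> s \<beta> = triple z \<alpha> t \<beta> \<longleftrightarrow> s = t"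
  by (auto simp: triple_def)

lemma triple_zero [simp]: "triple z \<alpha> z \<beta> = None"
  by (simp add: triple_def)

locale brandt_extension = monoid S for S :: "('a, 'b) monoid_scheme" (structure) +
  fixes I :: "'i set" and z :: 'a
  assumes index_ne: "I \<noteq> {}" and zero: "is_zero S z"
begin

abbreviation B where "B \<equiv> brandt0 I S z"

abbreviation tr where "tr \<equiv> triple z"

lemma zero_closed [simp]: "z \<in> carrier S"
  and zero_mult [simp]: "s \<in> carrier S \<Longrightarrow> z \<otimes> s = z"
  and mult_zero [simp]: "s \<in> carrier S \<Longrightarrow> s \<otimes> z = z"
  using zero by (auto simp: is_zero_def)

lemma triple_closed [simp]:
  "\<alpha> \<in> I \<Longrightarrow> s \<in> carrier S \<Longrightarrow> \<beta> \<in> I \<Longrightarrow> tr \<alpha> s \<beta> \<in> carrier B"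
  by (auto simp: triple_def carrier_brandt0)

lemma brandt0_cases:
  assumes "x \<in> carrier B"
  obtains \<alpha> s \<beta> where "\<alpha> \<in> I" "s \<in> carrier S" "\<beta> \<in> I" "x = tr \<alpha> s \<beta>"
proof (cases x)
  case None
  obtain \<alpha> where "\<alpha> \<in> I"
    using index_ne by auto
  with None show ?thesis
    by (intro that[of \<alpha> z \<alpha>]) auto
next
  case (Some y)
  then obtain \<alpha> s \<beta> where "x = Some (\<alpha>, s, \<beta>)"
    by (metis prod_cases3)
  with assms show ?thesis
    by (intro that[of \<alpha> s \<beta>]) (auto simp: carrier_brandt0 triple_def)
qed

lemma triple_mult:
  assumes "\<alpha> \<in> I" "s \<in> carrier S" "\<beta> \<in> I" "\<gamma> \<in> I" "t \<in> carrier S" "\<delta> \<in> I"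
  shows "tr \<alpha> s \<beta> \<otimes>\<^bsub>B\<^esub> tr \<gamma> t \<delta> = (if \<beta> = \<gamma> then tr \<alpha> (s \<otimes> t) \<delta> else None)"
  using assms
  by (auto simp: triple_def brandt0_def rees_quotient_def brandt_def brandt_ideal_def)

lemma None_closed [simp]: "None \<in> carrier B"
  by (simp add: carrier_brandt0)

lemma is_zero_None: "is_zero B None"
proof -
  have "brandt_mult S x None = None" for x :: "('i \<times> 'a \<times> 'i) option"
    by (cases x) auto
  then show ?thesis
    by (simp add: is_zero_def brandt0_def rees_quotient_def brandt_def brandt_ideal_def)
qed

lemma None_mult [simp]: "x \<in> carrier B \<Longrightarrow> None \<otimes>\<^bsub>B\<^esub> x = None"
  and mult_None [simp]: "x \<in> carrier B \<Longrightarrow> x \<otimes>\<^bsub>B\<^esub> None = None"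
  using is_zero_None by (auto simp: is_zero_def)

lemma brandt0_mult_closed: "mult B \<in> carrier B \<rightarrow> carrier B \<rightarrow> carrier B"
proof (intro funcsetI)
  fix x y assume "x \<in> carrier B" "y \<in> carrier B"
  then show "x \<otimes>\<^bsub>B\<^esub> y \<in> carrier B"
    by (elim brandt0_cases) (simp add: triple_mult)
qed

lemma group_aut_brandt0: "group (aut_group B)"
  by (rule group_aut_group[OF brandt0_mult_closed])

section \<open>From triples to automorphisms\<close>

text \<open>The formula for \<open>[\<phi>, h, u]\<close> also holds for a vanishing middle component, because
  automorphisms of \<open>S\<close> fix its zero.\<close>

lemma triple_aut_triple:
  assumes "(\<phi>, h, u) \<in> carrier (triple_group I S)" "\<alpha> \<in> I" "s \<in> carrier S" "\<beta> \<in> I"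
  shows "triple_aut I S z (\<phi>, h, u) (tr \<alpha> s \<beta>) = tr (\<phi> \<alpha>) (u \<alpha> \<otimes> h s \<otimes> inv (u \<beta>)) (\<phi> \<beta>)"
proof (cases "s = z")
  case True
  then show ?thesis
    using assms auto_zero[OF _ zero, of h]
    by (auto simp: carrier_triple_group PiE_iff Units_closed)
next
  case False
  have h: "h \<in> auto S" and u: "u \<alpha> \<in> Units S" "u \<beta> \<in> Units S"
    using assms by (auto simp: carrier_triple_group)
  have "h s \<noteq> z"
    using auto_zero[OF h zero] auto_inj[OF h] False assms(3) by (metis inj_onD zero_closed)
  moreover have "h s = inv (u \<alpha>) \<otimes> (u \<alpha> \<otimes> h s \<otimes> inv (u \<beta>)) \<otimes> u \<beta>"
  proof -
    have "inv (u \<alpha>) \<otimes> (u \<alpha> \<otimes> h s \<otimes> inv (u \<beta>)) \<otimes> u \<beta>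
      = (inv (u \<alpha>) \<otimes> u \<alpha>) \<otimes> h s \<otimes> (inv (u \<beta>) \<otimes> u \<beta>)"
      using u auto_closed[OF h assms(3)] by (simp add: m_assoc Units_closed del: Units_l_inv)
    then show ?thesis
      using u auto_closed[OF h assms(3)] by simp
  qed
  \<comment> \<open>Multiplication by units on both sides is undone by their inverses, so it kills only zero.\<close>
  ultimately have "u \<alpha> \<otimes> h s \<otimes> inv (u \<beta>) \<noteq> z"
    using u by (metis Units_closed Units_inv_closed mult_zero zero_mult)
  with False assms show ?thesis
    by (simp add: triple_def carrier_brandt0)
qed

lemma triple_aut_closed:
  assumes t: "t \<in> carrier (triple_group I S)" and "x \<in> carrier B"
  shows "triple_aut I S z t x \<in> carrier B"
proof -
  obtain \<phi> h u where t_eq: "t = (\<phi>, h, u)"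
    by (cases t)
  from \<open>x \<in> carrier B\<close> show ?thesis
  proof (cases rule: brandt0_cases)
    case (1 \<alpha> s \<beta>)
    then show ?thesis
      using t unfolding t_eq
      by (auto simp: triple_aut_triple carrier_triple_group Bij_imp_funcset[THEN funcset_mem]
          auto_closed Units_closed PiE_iff intro!: triple_closed m_closed simp del: triple_aut.simps)
  qed
qed

lemma triple_aut_extensional: "triple_aut I S z t \<in> extensional (carrier B)"
  by (cases t) auto

text \<open>Each triple respects products: the factor \<open>((\<beta>)u)\<inverse>\<close> on the right of one factor cancels
  \<open>(\<beta>)u\<close> on the left of the next.\<close>

lemma triple_aut_hom:
  assumes t: "t \<in> carrier (triple_group I S)"
  shows "triple_aut I S z t \<in> hom B B"
proof (rule homI)
  obtain \<phi> h u where t_eq: "t = (\<phi>, h, u)"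
    by (cases t)
  have \<phi>: "\<phi> \<in> Bij I" and h: "h \<in> auto S" and u: "\<And>\<alpha>. \<alpha> \<in> I \<Longrightarrow> u \<alpha> \<in> Units S"
    using t unfolding t_eq by (auto simp: carrier_triple_group)
  fix x y assume "x \<in> carrier B" "y \<in> carrier B"
  then obtain \<alpha> s \<beta> \<gamma> r \<delta> where
    x: "\<alpha> \<in> I" "s \<in> carrier S" "\<beta> \<in> I" "x = tr \<alpha> s \<beta>" and
    y: "\<gamma> \<in> I" "r \<in> carrier S" "\<delta> \<in> I" "y = tr \<gamma> r \<delta>"
    by (elim brandt0_cases) blast
  have \<phi>_mem: "\<phi> \<epsilon> \<in> I" if "\<epsilon> \<in> I" for \<epsilon>
    using Bij_imp_funcset[OF \<phi>] that by auto
  have mem: "u \<epsilon> \<otimes> h a \<otimes> inv (u \<zeta>) \<in> carrier S"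
    if "\<epsilon> \<in> I" "a \<in> carrier S" "\<zeta> \<in> I" for \<epsilon> a \<zeta>
    using that u h by (simp add: auto_closed Units_closed)
  note image = triple_aut_triple[OF t[unfolded t_eq]]
  show "triple_aut I S z t (x \<otimes>\<^bsub>B\<^esub> y) = triple_aut I S z t x \<otimes>\<^bsub>B\<^esub> triple_aut I S z t y"
  proof (cases "\<beta> = \<gamma>")
    case True
    have "u \<alpha> \<otimes> h s \<otimes> inv (u \<gamma>) \<otimes> (u \<gamma> \<otimes> h r \<otimes> inv (u \<delta>))
      = u \<alpha> \<otimes> h s \<otimes> (inv (u \<gamma>) \<otimes> u \<gamma>) \<otimes> h r \<otimes> inv (u \<delta>)"
      using x y u h by (simp add: m_assoc auto_closed Units_closed del: Units_l_inv)
    also have "\<dots> = u \<alpha> \<otimes> h (s \<otimes> r) \<otimes> inv (u \<delta>)"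
      using x y u h by (simp add: m_assoc auto_mult auto_closed Units_closed)
    finally show ?thesis
      using x y True by (simp add: t_eq triple_mult image \<phi>_mem mem del: triple_aut.simps)
  next
    case False
    then have "\<phi> \<beta> \<noteq> \<phi> \<gamma>"
      using \<phi> x y by (auto simp: Bij_def bij_betw_def inj_on_def)
    moreover have "triple_aut I S z t None = None"
      by (simp add: t_eq)
    ultimately show ?thesis
      using x y False by (simp add: t_eq triple_mult image \<phi>_mem mem del: triple_aut.simps)
  qed
qed (rule triple_aut_closed[OF t])

lemma triple_aut_mult:
  assumes t: "t \<in> carrier (triple_group I S)" and t': "t' \<in> carrier (triple_group I S)"
  shows "triple_aut I S z (t \<otimes>\<^bsub>triple_group I S\<^esub> t')
    = compose (carrier B) (triple_aut I S z t') (triple_aut I S z t)"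
proof (rule extensionalityI[OF triple_aut_extensional compose_extensional])
  obtain \<phi> h u \<phi>' h' u' where eqs: "t = (\<phi>, h, u)" "t' = (\<phi>', h', u')"
    by (cases t, cases t')
  have \<phi>: "\<phi> \<in> Bij I" and h: "h \<in> auto S" and u: "\<And>\<alpha>. \<alpha> \<in> I \<Longrightarrow> u \<alpha> \<in> Units S"
    and h': "h' \<in> auto S" and u': "\<And>\<alpha>. \<alpha> \<in> I \<Longrightarrow> u' \<alpha> \<in> Units S"
    using t t' unfolding eqs by (auto simp: carrier_triple_group)
  have \<phi>_mem: "\<phi> \<epsilon> \<in> I" if "\<epsilon> \<in> I" for \<epsilon>
    using Bij_imp_funcset[OF \<phi>] that by auto
  have prod: "t \<otimes>\<^bsub>triple_group I S\<^esub> t' \<in> carrier (triple_group I S)"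
    using monoid.m_closed[OF group.is_monoid[OF group_triple_group]] t t' by blast
  fix x assume xB: "x \<in> carrier B"
  then obtain \<alpha> s \<beta> where x: "\<alpha> \<in> I" "s \<in> carrier S" "\<beta> \<in> I" "x = tr \<alpha> s \<beta>"
    by (elim brandt0_cases) blast
  have "triple_aut I S z (t \<otimes>\<^bsub>triple_group I S\<^esub> t') x
    = tr (\<phi>' (\<phi> \<alpha>)) (u' (\<phi> \<alpha>) \<otimes> h' (u \<alpha>) \<otimes> h' (h s) \<otimes> inv (u' (\<phi> \<beta>) \<otimes> h' (u \<beta>))) (\<phi>' (\<phi> \<beta>))"
    using triple_aut_triple[OF prod[unfolded eqs mult_triple_group]] x
    by (simp add: eqs mult_triple_group compose_eq del: triple_aut.simps)
  also have "u' (\<phi> \<alpha>) \<otimes> h' (u \<alpha>) \<otimes> h' (h s) \<otimes> inv (u' (\<phi> \<beta>) \<otimes> h' (u \<beta>))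
    = u' (\<phi> \<alpha>) \<otimes> h' (u \<alpha> \<otimes> h s \<otimes> inv (u \<beta>)) \<otimes> inv (u' (\<phi> \<beta>))"
    using x u u' h h' \<phi>_mem
    by (simp add: inv_mult_Units auto_Units auto_mult auto_closed Units_closed m_assoc)
  also have "tr (\<phi>' (\<phi> \<alpha>)) \<dots> (\<phi>' (\<phi> \<beta>)) = triple_aut I S z t' (triple_aut I S z t x)"
    using x u h \<phi>_mem triple_aut_triple[OF t[unfolded eqs]] triple_aut_triple[OF t'[unfolded eqs]]
    by (simp add: eqs auto_closed Units_closed del: triple_aut.simps)
  finally show "triple_aut I S z (t \<otimes>\<^bsub>triple_group I S\<^esub> t') x
    = compose (carrier B) (triple_aut I S z t') (triple_aut I S z t) x"
    using xB by (simp add: compose_eq)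
qed

lemma triple_aut_one: "triple_aut I S z \<one>\<^bsub>triple_group I S\<^esub> = (\<lambda>x\<in>carrier B. x)"
proof (rule extensionalityI[OF triple_aut_extensional restrict_extensional])
  fix x assume xB: "x \<in> carrier B"
  have "\<one>\<^bsub>triple_group I S\<^esub> \<in> carrier (triple_group I S)"
    using monoid.one_closed[OF group.is_monoid[OF group_triple_group]] .
  from triple_aut_triple[OF this[unfolded one_triple_group]] xB
  show "triple_aut I S z \<one>\<^bsub>triple_group I S\<^esub> x = (\<lambda>x\<in>carrier B. x) x"
    by (elim brandt0_cases) (simp add: one_triple_group del: triple_aut.simps)
qed

text \<open>Bijectivity needs no separate argument: the assignment of maps to triples is multiplicative and
  sends the identity to the identity, so the inverse triple gives the inverse map.\<close>

lemma triple_aut_auto: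
  assumes t: "t \<in> carrier (triple_group I S)"
  shows "triple_aut I S z t \<in> auto B"
proof -
  interpret T: group "triple_group I S"
    by (rule group_triple_group)
  let ?f = "triple_aut I S z t" and ?g = "triple_aut I S z (inv\<^bsub>triple_group I S\<^esub> t)"
  have "compose (carrier B) ?g ?f = (\<lambda>x\<in>carrier B. x)"
    "compose (carrier B) ?f ?g = (\<lambda>x\<in>carrier B. x)"
    using t by (simp_all add: triple_aut_mult[symmetric] triple_aut_one)
  then have "?g (?f x) = x" "?f (?g x) = x" if "x \<in> carrier B" for x
    using that by (simp_all add: compose_def fun_eq_iff split: if_splits)
  then have "bij_betw ?f (carrier B) (carrier B)"
    using t by (intro bij_betw_byWitness[where f' = ?g]) (auto simp: triple_aut_closed)
  with t show ?thesis
    by (simp add: auto_def Bij_def triple_aut_hom triple_aut_extensional)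
qed

section \<open>From automorphisms to triples\<close>

abbreviation idem where "idem \<alpha> \<equiv> tr \<alpha> \<one> \<alpha>"

lemma right_identity_idem:
  assumes ne: "\<one> \<noteq> z" and "\<alpha> \<in> I" "y \<in> carrier B" "idem \<alpha> \<otimes>\<^bsub>B\<^esub> y = idem \<alpha>"
  shows "y = idem \<alpha>"
  using \<open>y \<in> carrier B\<close>
proof (cases rule: brandt0_cases)
  case (1 \<gamma> s \<delta>)
  then have "(if \<alpha> = \<gamma> then tr \<alpha> s \<delta> else None) = tr \<alpha> \<one> \<alpha>"
    using assms by (simp add: triple_mult split: if_splits)
  then have "\<gamma> = \<alpha> \<and> s = \<one> \<and> \<delta> = \<alpha>"
    using ne by (auto simp: triple_def split: if_splits)
  with 1 show ?thesis
    by simp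
qed

text \<open>If \<open>1 \<noteq> 0\<^sub>S\<close>, the elements \<open>(\<alpha>, 1, \<alpha>)\<close> are recognisable from the multiplication alone: every nonzero
  element has one of them as a right identity, and each of them is its only own right identity.
  Hence automorphisms permute them, and this is how a permutation of the index set arises.\<close>

lemma auto_idem:
  assumes ne: "\<one> \<noteq> z" and \<sigma>: "\<sigma> \<in> auto B" and \<alpha>: "\<alpha> \<in> I"
  shows "\<exists>\<beta>\<in>I. \<sigma> (idem \<alpha>) = idem \<beta>"
proof -
  obtain \<gamma> s \<beta> where img: "\<gamma> \<in> I" "s \<in> carrier S" "\<beta> \<in> I" "\<sigma> (idem \<alpha>) = tr \<gamma> s \<beta>"
    using auto_closed[OF \<sigma>] \<alpha> by (metis brandt0_cases one_closed triple_closed)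
  obtain y where y: "y \<in> carrier B" "\<sigma> y = idem \<beta>"
    using auto_image[OF \<sigma>] img(3) by (metis imageE one_closed triple_closed)
  have "\<sigma> (idem \<alpha> \<otimes>\<^bsub>B\<^esub> y) = \<sigma> (idem \<alpha>)"
    using \<alpha> y img by (simp add: auto_mult[OF \<sigma>] triple_mult)
  moreover have "idem \<alpha> \<otimes>\<^bsub>B\<^esub> y \<in> carrier B"
    using brandt0_mult_closed \<alpha> y by (auto simp: Pi_iff)
  ultimately have "idem \<alpha> \<otimes>\<^bsub>B\<^esub> y = idem \<alpha>"
    using auto_inj[OF \<sigma>] \<alpha> by (auto dest: inj_onD)
  then have "y = idem \<alpha>"
    using right_identity_idem ne \<alpha> y by blast
  with y img show ?thesis
    by auto
qed

text \<open>The idempotents also see the indices of an element, which is how automorphisms turn out to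
  respect indices.\<close>

lemma corner:
  assumes "\<alpha> \<in> I" "\<beta> \<in> I" "x \<in> carrier B" "idem \<alpha> \<otimes>\<^bsub>B\<^esub> x = x" "x \<otimes>\<^bsub>B\<^esub> idem \<beta> = x"
  shows "\<exists>s\<in>carrier S. x = tr \<alpha> s \<beta>"
  using \<open>x \<in> carrier B\<close>
proof (cases rule: brandt0_cases)
  case (1 \<gamma> s \<delta>)
  then have eqs: "(if \<alpha> = \<gamma> then tr \<alpha> s \<delta> else None) = x"
    "(if \<delta> = \<beta> then tr \<gamma> s \<beta> else None) = x"
    using assms by (simp_all add: triple_mult split: if_splits)
  show ?thesis
  proof (cases "x = None")
    case True
    then show ?thesis
      by (intro bexI[of _ z]) simp_all
  next
    case False
    then have "\<alpha> = \<gamma>" "\<delta> = \<beta>"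
      using eqs by (simp_all split: if_splits)
    with 1 show ?thesis
      by (intro bexI[of _ s]) simp_all
  qed
qed

lemma auto_eq_triple_aut:
  assumes ne: "\<one> \<noteq> z" and \<sigma>: "\<sigma> \<in> auto B"
  shows "\<exists>t\<in>carrier (triple_group I S). triple_aut I S z t = \<sigma>"
proof -
  define \<tau> where "\<tau> = restrict (inv_into (carrier B) \<sigma>) (carrier B)"
  have \<tau>: "\<tau> \<in> auto B"
    unfolding \<tau>_def by (rule inverse_in_auto[OF brandt0_mult_closed \<sigma>])
  have \<tau>\<sigma>: "\<tau> (\<sigma> x) = x" and \<sigma>\<tau>: "\<sigma> (\<tau> x) = x" if "x \<in> carrier B" for x
    using that auto_image[OF \<sigma>] auto_inj[OF \<sigma>] auto_closed[OF \<sigma> that]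
    by (simp_all add: \<tau>_def f_inv_into_f)
  obtain \<phi>0 where \<phi>0: "\<And>\<alpha>. \<alpha> \<in> I \<Longrightarrow> \<phi>0 \<alpha> \<in> I \<and> \<sigma> (idem \<alpha>) = idem (\<phi>0 \<alpha>)"
    using auto_idem[OF ne \<sigma>] by metis
  define \<phi> where "\<phi> = restrict \<phi>0 I"
  have \<phi>_mem: "\<phi> \<alpha> \<in> I" and \<phi>_idem: "\<sigma> (idem \<alpha>) = idem (\<phi> \<alpha>)" if "\<alpha> \<in> I" for \<alpha>
    using \<phi>0[OF that] that by (auto simp: \<phi>_def)
  have idem_inj: "\<alpha> = \<beta>" if "idem \<alpha> = idem \<beta>" for \<alpha> \<beta> :: 'i
    using that ne by (simp add: triple_def)
  have \<tau>_idem: "\<tau> (idem (\<phi> \<alpha>)) = idem \<alpha>" if "\<alpha> \<in> I" for \<alpha>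
    using \<tau>\<sigma>[of "idem \<alpha>"] \<phi>_idem[OF that] that by simp
  have \<phi>: "\<phi> \<in> Bij I"
  proof -
    have "inj_on \<phi> I"
      by (metis (no_types, lifting) \<tau>_idem idem_inj inj_onI)
    moreover have "\<beta> \<in> \<phi> ` I" if "\<beta> \<in> I" for \<beta>
    proof -
      obtain \<alpha> where "\<alpha> \<in> I" "\<tau> (idem \<beta>) = idem \<alpha>"
        using auto_idem[OF ne \<tau> \<open>\<beta> \<in> I\<close>] by auto
      then have "\<phi> \<alpha> = \<beta>"
        by (metis \<phi>_idem \<sigma>\<tau> idem_inj one_closed that triple_closed)
      with \<open>\<alpha> \<in> I\<close> show ?thesis
        by auto
    qed
    ultimately show ?thesis
      using \<phi>_mem by (auto simp: Bij_def bij_betw_def \<phi>_def)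
  qed
  \<comment> \<open>Multiplying by the idempotents on both sides shows that both maps respect index pairs.\<close>
  have \<sigma>_corner: "\<exists>r\<in>carrier S. \<sigma> (tr \<alpha> s \<beta>) = tr (\<phi> \<alpha>) r (\<phi> \<beta>)"
    if "\<alpha> \<in> I" "s \<in> carrier S" "\<beta> \<in> I" for \<alpha> s \<beta>
  proof (rule corner)
    show "idem (\<phi> \<alpha>) \<otimes>\<^bsub>B\<^esub> \<sigma> (tr \<alpha> s \<beta>) = \<sigma> (tr \<alpha> s \<beta>)"
      using that auto_mult[OF \<sigma>, of "idem \<alpha>" "tr \<alpha> s \<beta>"]
      by (simp add: \<phi>_idem triple_mult)
    show "\<sigma> (tr \<alpha> s \<beta>) \<otimes>\<^bsub>B\<^esub> idem (\<phi> \<beta>) = \<sigma> (tr \<alpha> s \<beta>)"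
      using that auto_mult[OF \<sigma>, of "tr \<alpha> s \<beta>" "idem \<beta>"]
      by (simp add: \<phi>_idem triple_mult)
  qed (use that in \<open>simp_all add: \<phi>_mem auto_closed[OF \<sigma>]\<close>)
  have \<tau>_corner: "\<exists>s\<in>carrier S. \<tau> (tr (\<phi> \<alpha>) r (\<phi> \<beta>)) = tr \<alpha> s \<beta>"
    if "\<alpha> \<in> I" "r \<in> carrier S" "\<beta> \<in> I" for \<alpha> r \<beta>
  proof (rule corner)
    show "idem \<alpha> \<otimes>\<^bsub>B\<^esub> \<tau> (tr (\<phi> \<alpha>) r (\<phi> \<beta>)) = \<tau> (tr (\<phi> \<alpha>) r (\<phi> \<beta>))"
      using that auto_mult[OF \<tau>, of "idem (\<phi> \<alpha>)" "tr (\<phi> \<alpha>) r (\<phi> \<beta>)"]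
      by (simp add: \<tau>_idem triple_mult \<phi>_mem)
    show "\<tau> (tr (\<phi> \<alpha>) r (\<phi> \<beta>)) \<otimes>\<^bsub>B\<^esub> idem \<beta> = \<tau> (tr (\<phi> \<alpha>) r (\<phi> \<beta>))"
      using that auto_mult[OF \<tau>, of "tr (\<phi> \<alpha>) r (\<phi> \<beta>)" "idem (\<phi> \<beta>)"]
      by (simp add: \<tau>_idem triple_mult \<phi>_mem)
  qed (use that in \<open>simp_all add: \<phi>_mem auto_closed[OF \<tau>]\<close>)
  obtain m where m: "\<And>\<alpha> s \<beta>. \<alpha> \<in> I \<Longrightarrow> s \<in> carrier S \<Longrightarrow> \<beta> \<in> I \<Longrightarrow>
      m \<alpha> s \<beta> \<in> carrier S \<and> \<sigma> (tr \<alpha> s \<beta>) = tr (\<phi> \<alpha>) (m \<alpha> s \<beta>) (\<phi> \<beta>)"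
    using \<sigma>_corner by metis
  have m_mem: "m \<alpha> s \<beta> \<in> carrier S"
    and \<sigma>_tr: "\<sigma> (tr \<alpha> s \<beta>) = tr (\<phi> \<alpha>) (m \<alpha> s \<beta>) (\<phi> \<beta>)"
    if "\<alpha> \<in> I" "s \<in> carrier S" "\<beta> \<in> I" for \<alpha> s \<beta>
    using m[OF that] by auto
  have m_mult: "m \<alpha> (s \<otimes> r) \<gamma> = m \<alpha> s \<beta> \<otimes> m \<beta> r \<gamma>"
    if "\<alpha> \<in> I" "s \<in> carrier S" "\<beta> \<in> I" "r \<in> carrier S" "\<gamma> \<in> I" for \<alpha> s \<beta> r \<gamma>
  proof -
    have "\<sigma> (tr \<alpha> s \<beta> \<otimes>\<^bsub>B\<^esub> tr \<beta> r \<gamma>) = \<sigma> (tr \<alpha> s \<beta>) \<otimes>\<^bsub>B\<^esub> \<sigma> (tr \<beta> r \<gamma>)"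
      using that by (simp add: auto_mult[OF \<sigma>])
    then show ?thesis
      using that by (simp add: triple_mult \<sigma>_tr \<phi>_mem m_mem)
  qed
  have m_one: "m \<alpha> \<one> \<alpha> = \<one>" if "\<alpha> \<in> I" for \<alpha>
    using \<sigma>_tr[of \<alpha> \<one> \<alpha>] \<phi>_idem[OF that] that by simp
  obtain \<omega> where \<omega>: "\<omega> \<in> I"
    using index_ne by auto
  define h where "h = (\<lambda>s\<in>carrier S. m \<omega> s \<omega>)"
  define u where "u = (\<lambda>\<alpha>\<in>I. m \<alpha> \<one> \<omega>)"
  have h: "h \<in> auto S"
  proof -
    have "inj_on h (carrier S)"
    proof (rule inj_onI)
      fix s r assume sr: "s \<in> carrier S" "r \<in> carrier S" "h s = h r"
      then have "\<sigma> (tr \<omega> s \<omega>) = \<sigma> (tr \<omega> r \<omega>)"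
        using \<omega> by (simp add: \<sigma>_tr h_def)
      then have "tr \<omega> s \<omega> = tr \<omega> r \<omega>"
        using auto_inj[OF \<sigma>] \<omega> sr by (metis inj_onD triple_closed)
      then show "s = r"
        by simp
    qed
    moreover have "r \<in> h ` carrier S" if r: "r \<in> carrier S" for r
    proof -
      obtain s where s: "s \<in> carrier S" "\<tau> (tr (\<phi> \<omega>) r (\<phi> \<omega>)) = tr \<omega> s \<omega>"
        using \<tau>_corner \<omega> r by blast
      then have "tr (\<phi> \<omega>) r (\<phi> \<omega>) = \<sigma> (tr \<omega> s \<omega>)"
        using \<sigma>\<tau>[of "tr (\<phi> \<omega>) r (\<phi> \<omega>)"] \<omega> r \<phi>_mem by simp
      then have "r = h s"
        using s \<omega> by (simp add: \<sigma>_tr h_def)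
      with s show ?thesis
        by auto
    qed
    moreover have "h \<in> hom S S"
      using \<omega> m_mem by (intro homI) (auto simp: h_def intro: m_mult)
    ultimately show ?thesis
      using \<omega> by (auto simp: auto_def Bij_def bij_betw_def h_def m_mem)
  qed
  have u_unit: "u \<alpha> \<in> Units S" and u_inv: "inv (u \<alpha>) = m \<omega> \<one> \<alpha>" if "\<alpha> \<in> I" for \<alpha>
  proof -
    have eqs: "u \<alpha> \<otimes> m \<omega> \<one> \<alpha> = \<one>" "m \<omega> \<one> \<alpha> \<otimes> u \<alpha> = \<one>"
      using m_mult[of \<alpha> \<one> \<omega> \<one> \<alpha>] m_mult[of \<omega> \<one> \<alpha> \<one> \<omega>] that \<omega> by (simp_all add: u_def m_one)
    moreover have "u \<alpha> \<in> carrier S" "m \<omega> \<one> \<alpha> \<in> carrier S"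
      using that \<omega> by (simp_all add: u_def m_mem)
    ultimately show "u \<alpha> \<in> Units S" "inv (u \<alpha>) = m \<omega> \<one> \<alpha>"
      by (auto simp: Units_def intro: inv_unique'[symmetric])
  qed
  have t: "(\<phi>, h, u) \<in> carrier (triple_group I S)"
    using \<phi> h u_unit by (auto simp: carrier_triple_group u_def)
  have "triple_aut I S z (\<phi>, h, u) = \<sigma>"
  proof (rule extensionalityI[OF triple_aut_extensional auto_extensional[OF \<sigma>]])
    fix x assume "x \<in> carrier B"
    then obtain \<alpha> s \<beta> where x: "\<alpha> \<in> I" "s \<in> carrier S" "\<beta> \<in> I" "x = tr \<alpha> s \<beta>"
      by (elim brandt0_cases) blast
    \<comment> \<open>Factor \<open>(\<alpha>, s, \<beta>) = (\<alpha>, 1, \<omega>) (\<omega>, s, \<omega>) (\<omega>, 1, \<beta>)\<close>.\<close>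
    have "u \<alpha> \<otimes> h s \<otimes> inv (u \<beta>) = m \<alpha> s \<beta>"
      using x \<omega> m_mult[of \<alpha> \<one> \<omega> s \<omega>] m_mult[of \<alpha> s \<omega> \<one> \<beta>]
      by (simp add: u_inv) (simp add: u_def h_def)
    then show "triple_aut I S z (\<phi>, h, u) x = \<sigma> x"
      using x by (simp add: triple_aut_triple[OF t] \<sigma>_tr del: triple_aut.simps)
  qed
  with t show ?thesis
    by blast
qed

lemma triple_aut_epi: "triple_aut I S z \<in> epi (triple_group I S) (aut_group B)"
proof -
  have "\<exists>t\<in>carrier (triple_group I S). triple_aut I S z t = \<sigma>" if \<sigma>: "\<sigma> \<in> auto B" for \<sigma>
  proof (cases "\<one> = z")
    case False
    then show ?thesis
      using auto_eq_triple_aut \<sigma> by blast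
  next
    \<comment> \<open>If the monoid is trivial, then its Brandt extension is the zero semigroup with one element.\<close>
    case True
    have "carrier S = {z}"
      using True by (metis (no_types, lifting) empty_iff l_one singletonI subsetI subset_singletonD
          zero_closed zero_mult)
    then have "carrier B = {None}"
      by (auto simp: carrier_brandt0)
    then have "\<sigma> = (\<lambda>x\<in>carrier B. x)"
      using auto_closed[OF \<sigma>] auto_extensional[OF \<sigma>] by (auto simp: fun_eq_iff extensional_def)
    then show ?thesis
      using triple_aut_one monoid.one_closed[OF group.is_monoid[OF group_triple_group]] by blast
  qed
  then show ?thesis
    by (auto simp: epi_def hom_def aut_group_def triple_aut_auto triple_aut_mult image_iff
        simp del: triple_aut.simps)
qed

lemma inv_triple_aut:
  assumes "t \<in> carrier (triple_group I S)"
  shows "inv\<^bsub>aut_group B\<^esub> (triple_aut I S z t) = triple_aut I S z (triple_inv I S t)"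
proof -
  have "group_hom (triple_group I S) (aut_group B) (triple_aut I S z)"
    using triple_aut_epi group_triple_group group_aut_brandt0
    by (auto simp: group_hom_def group_hom_axioms_def epi_def)
  then show ?thesis
    using group_hom.hom_inv assms inv_triple_group by metis
qed

end

theorem theorem2:
  fixes I :: "'i set" and S :: "('a, 'b) monoid_scheme" and z :: 'a
  assumes "I \<noteq> {}" and "monoid S" and "is_zero S z"
  shows "group (triple_group I S) \<and>
    group (aut_group (brandt0 I S z)) \<and>
    (\<exists>K :: (('i \<times> 'a \<times> 'i) option \<Rightarrow> ('i \<times> 'a \<times> 'i) option) monoid.
       group K \<and> epi (triple_group I S) K \<noteq> {} \<and> aut_group (brandt0 I S z) \<cong> K) \<and>
    (\<forall>t \<in> carrier (triple_group I S).
       triple_inv I S t \<in> carrier (triple_group I S) \<and>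
       triple_aut I S z t \<in> carrier (aut_group (brandt0 I S z)) \<and>
       inv\<^bsub>aut_group (brandt0 I S z)\<^esub> (triple_aut I S z t) = triple_aut I S z (triple_inv I S t))"
proof -
  interpret brandt_extension S I z
    using assms by (simp add: brandt_extension_def brandt_extension_axioms_def)
  have "triple_aut I S z t \<in> carrier (aut_group B)" if "t \<in> carrier (triple_group I S)" for t
    using triple_aut_auto[OF that] by (simp add: aut_group_def)
  then show ?thesis
    using group_triple_group group_aut_brandt0 triple_aut_epi iso_refl triple_inv_closed inv_triple_aut
    by blast
qed

end
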